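(* Let $(Z_n)_{n\ge 0}$ be a real-valued centered process with stationary increments. Assume that there is an $\varepsilon>0$ such that $$\rho:=\liminf_{n\to+\infty}\frac{\mathbb E[Z^*_{n+\lfloor\varepsilon n\rfloor}]}{\mathbb E[Z_n^*]}>1.$$ (i) If $b$ is a real number with $\mathbb P(-Z_1\le b)=1$, then $$\liminf_{n\to+\infty}\frac{\varepsilon n}{\mathbb E[Z_n^*]}\,\mathbb P(Z_n^*<0)\ge\frac{\rho-1}{b}.$$ Assume from now on that $(b_n)_n$ is a sequence of positive numbers such that $$K:=\limsup_{n\to+\infty} n\,\mathbb P(-Z_1>b_n)<+\infty,$$ and that at least one of the following two assumptions (ii), (iii) holds: (ii) There exists $p>1$ such that $$\kappa:=\limsup_{n\to+\infty}\,(\mathbb E[Z_n^*])^{-1}\,\big\Vert Z^*_{n+\lfloor\varepsilon n\rfloor}-Z_{n+\lfloor\varepsilon n\rfloor}\big\Vert_p<+\infty.$$ (iii) There exists a sub-$\sigma$-algebra $\mathcal F_0$ of $\mathcal F$ such that, given $\mathcal F_0$, the increments of $Z$ are positively associated and their common conditional distribution is independent of $\mathcal F_0$, and moreover $$\rho>\limsup_{n\to+\infty}\frac{\mathbb E\left[\max\left(0,Z^*_{\lfloor\varepsilon n\rfloor+1,\,n+\lfloor\varepsilon n\rfloor}\right)\right]}{\mathbb E[Z_n^*]}.\qquad(\star)$$ Then there is a positive integer $d$ such that $$\liminf_{n\to+\infty}\frac{n\,b_{dn}}{\mathbb E[Z_n^*]}\,\mathbb P(Z_n^*<0)>0.$$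 Moreover, condition $(\star)$ holds if $\rho>1+\limsup_{n\to+\infty}\frac{\mathbb E[\max(0,Z_{\lfloor\varepsilon n\rfloor+1})]}{\mathbb E[Z_n^*]}$.
   Context: All processes are defined on a probability space $(\Omega,\mathcal F,\mathbb P)$. A discrete-time process $(Z_n)_{n\ge 0}$ has stationary increments if for every integer $k\ge 0$ the sequences $(Z_{n+k}-Z_k)_{n\ge 0}$ and $(Z_n)_{n\ge 0}$ have the same law (in particular $Z_0=0$ almost surely). Centered means that each $Z_n$ is integrable with zero mean. Notation: $Z_n^*:=\max_{k=1,\ldots,n}Z_k$, $Z^*_{n,m}:=\max_{k=n,\ldots,m}Z_k$, and $\Vert\cdot\Vert_p$ is the $L^p(\mathbb P)$ norm. The increments of $Z$ are $Z_k-Z_{k-1}$, $k\ge1$. They are positively associated given $\mathcal F_0$ if for every $N$ and all bounded measurable coordinatewise nondecreasing $f,g:\mathbb R^N\to\mathbb R$, with $\Xi=(Z_1-Z_0,\ldots,Z_N-Z_{N-1})$, one has $\mathbb E[f(\Xi)g(\Xi)\mid\mathcal F_0]\ge\mathbb E[f(\Xi)\mid\mathcal F_0]\,\mathbb E[g(\Xi)\mid\mathcal F_0]$ almost surely. "Their common conditional distribution is independent of $\mathcal F_0$" means that for every $k\ge 1$ the conditional distribution of $Z_k-Z_{k-1}$ given $\mathcal F_0$ is almost surely the (unconditional) distribution of $Z_1$. *)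

theory Defs
  imports "HOL-Probability.Probability"
begin

definition stationary_increments :: "'a measure \<Rightarrow> (nat \<Rightarrow> 'a \<Rightarrow> real) \<Rightarrow> bool" where
  "stationary_increments M Z \<longleftrightarrow>
     (\<forall>k. distr M (\<Pi>\<^sub>M n\<in>(UNIV :: nat set). borel) (\<lambda>\<omega> n. Z (n + k) \<omega> - Z k \<omega>) =
          distr M (\<Pi>\<^sub>M n\<in>(UNIV :: nat set). borel) (\<lambda>\<omega> n. Z n \<omega>))"

definition centered :: "'a measure \<Rightarrow> (nat \<Rightarrow> 'a \<Rightarrow> real) \<Rightarrow> bool" where
  "centered M Z \<longleftrightarrow> (\<forall>n. integrable M (Z n) \<and> prob_space.expectation M (Z n) = 0)"

text \<open>The maximum of \<open>Z k\<close> over \<open>n \<le> k \<le> m\<close>; the value is unspecified when \<open>m < n\<close>.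
  In the asymptotic expressions below this only concerns the index 0.\<close>

definition run_max :: "(nat \<Rightarrow> 'a \<Rightarrow> real) \<Rightarrow> nat \<Rightarrow> nat \<Rightarrow> 'a \<Rightarrow> real" where
  "run_max Z n m \<omega> = (MAX k\<in>{n..m}. Z k \<omega>)"

abbreviation nfloor :: "real \<Rightarrow> nat \<Rightarrow> nat" where
  "nfloor \<epsilon> n \<equiv> nat \<lfloor>\<epsilon> * real n\<rfloor>"

text \<open>Extended-valued, so that a function outside \<open>L\<^sup>p\<close> has norm \<open>\<infinity>\<close>. Only used for Borel
  measurable functions and \<open>p > 0\<close>.\<close>

definition Lp_norm :: "'a measure \<Rightarrow> real \<Rightarrow> ('a \<Rightarrow> real) \<Rightarrow> ereal" where
  "Lp_norm M p f =
     (if integrable M (\<lambda>\<omega>. \<bar>f \<omega>\<bar> powr p)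
      then ereal ((\<integral>\<omega>. \<bar>f \<omega>\<bar> powr p \<partial>M) powr (1 / p)) else \<infinity>)"

text \<open>\<open>\<real>\<^sup>N\<close> is modelled as the space of the product measure on \<open>{..<N}\<close>, i.e. functions that are
  \<open>undefined\<close> off \<open>{..<N}\<close>. On it the pointwise order of functions is the coordinatewise order.
  Coordinate \<open>i\<close> carries the increment number \<open>i + 1\<close>.\<close>

definition increments :: "(nat \<Rightarrow> 'a \<Rightarrow> real) \<Rightarrow> nat \<Rightarrow> 'a \<Rightarrow> nat \<Rightarrow> real" where
  "increments Z N \<omega> = (\<lambda>i\<in>{..<N}. Z (Suc i) \<omega> - Z i \<omega>)"

definition test_fun :: "nat \<Rightarrow> ((nat \<Rightarrow> real) \<Rightarrow> real) \<Rightarrow> bool" where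
  "test_fun N f \<longleftrightarrow>
     f \<in> borel_measurable (\<Pi>\<^sub>M i\<in>{..<N}. borel) \<and>
     bounded (f ` space (\<Pi>\<^sub>M i\<in>{..<N}. (borel :: real measure))) \<and>
     mono_on (space (\<Pi>\<^sub>M i\<in>{..<N}. (borel :: real measure))) f"

definition pos_assoc_increments_given ::
    "'a measure \<Rightarrow> 'a measure \<Rightarrow> (nat \<Rightarrow> 'a \<Rightarrow> real) \<Rightarrow> bool" where
  "pos_assoc_increments_given M F Z \<longleftrightarrow>
     (\<forall>N f g. test_fun N f \<longrightarrow> test_fun N g \<longrightarrow>
        (AE \<omega> in M.
           real_cond_exp M F (\<lambda>\<omega>. f (increments Z N \<omega>) * g (increments Z N \<omega>)) \<omega> \<ge>
           real_cond_exp M F (\<lambda>\<omega>. f (increments Z N \<omega>)) \<omega> *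
           real_cond_exp M F (\<lambda>\<omega>. g (increments Z N \<omega>)) \<omega>))"

text \<open>\<open>Q\<close> is a regular version of the conditional distribution of the real random variable \<open>X\<close>
  given \<open>F\<close>. Such a version exists and is almost surely unique.\<close>

definition cond_distr :: "'a measure \<Rightarrow> 'a measure \<Rightarrow> ('a \<Rightarrow> real) \<Rightarrow> ('a \<Rightarrow> real measure) \<Rightarrow> bool" where
  "cond_distr M F X Q \<longleftrightarrow>
     Q \<in> measurable F (prob_algebra borel) \<and>
     (\<forall>B\<in>sets borel. AE \<omega> in M.
        real_cond_exp M F (indicator (X -` B \<inter> space M)) \<omega> = measure (Q \<omega>) B)"

definition cond_distr_increments_indep ::
    "'a measure \<Rightarrow> 'a measure \<Rightarrow> (nat \<Rightarrow> 'a \<Rightarrow> real) \<Rightarrow> bool" where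
  "cond_distr_increments_indep M F Z \<longleftrightarrow>
     (\<forall>k\<ge>1. \<exists>Q. cond_distr M F (\<lambda>\<omega>. Z k \<omega> - Z (k - 1) \<omega>) Q \<and>
        (AE \<omega> in M. Q \<omega> = distr M borel (Z 1)))"

definition star_condition :: "'a measure \<Rightarrow> (nat \<Rightarrow> 'a \<Rightarrow> real) \<Rightarrow> real \<Rightarrow> ereal \<Rightarrow> bool" where
  "star_condition M Z \<epsilon> \<rho> \<longleftrightarrow>
     \<rho> > limsup (\<lambda>n. ereal
       (prob_space.expectation M (\<lambda>\<omega>. max 0 (run_max Z (nfloor \<epsilon> n + 1) (n + nfloor \<epsilon> n) \<omega>)) /
        prob_space.expectation M (run_max Z 1 n)))"

end

theory Submission
  imports Defs
begin

text \<open>Fix \<open>n \<ge> 1\<close>, put \<open>m = \<lfloor>\<epsilon> n\<rfloor>\<close> and let \<open>S j\<close> be the maximum of \<open>Z\<close> over \<open>{j..m + n}\<close>. Then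
  \<open>S j - S (j + 1)\<close> is nonzero only if \<open>Z\<close> stays below \<open>Z j\<close> during \<open>{j + 1..m + n}\<close>, an event which by
  stationarity has probability at most \<open>P(Z\<^sub>n\<^sup>* < 0)\<close>, and it is at most \<open>c\<close> if the increment following \<open>j\<close>
  is at least \<open>- c\<close>. Summing over \<open>1 \<le> j \<le> m\<close>, the growth \<open>E S 1 - E S (m + 1)\<close> of the expected maximum,
  restricted to the event that no increment drops below \<open>- c\<close>, is at most \<open>m c P(Z\<^sub>n\<^sup>* < 0)\<close>; and
  \<open>E S (m + 1) = E Z\<^sub>n\<^sup>*\<close>. The exceptional event has probability at most \<open>m P(- Z\<^sub>1 > c)\<close>, which is small
  for \<open>c = b\<^bsub>d n\<^esub>\<close> and \<open>d\<close> large. On it, under (ii), \<open>S 1 - S (m + 1)\<close> is dominated by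
  \<open>S 1 - Z\<^bsub>m + n\<^esub>\<close> and controlled by its \<open>p\<close>-th moment. Under (iii), the exceptional event is
  decreasing and \<open>S 1\<close> increasing in the increments, so association bounds the expectation of \<open>S 1\<close> on it by
  \<open>m P(- Z\<^sub>1 > c) E S 1\<close>.\<close>

section \<open>Pathwise properties of running maxima\<close>

lemma run_max_ge: "j \<in> {a..b} \<Longrightarrow> Z j \<omega> \<le> run_max Z a b \<omega>"
  unfolding run_max_def by (rule Max_ge) auto

lemma run_max_less_iff: "a \<le> b \<Longrightarrow> run_max Z a b \<omega> < c \<longleftrightarrow> (\<forall>j\<in>{a..b}. Z j \<omega> < c)"
  unfolding run_max_def by (subst Max_less_iff) auto

lemma run_max_rec: "a < b \<Longrightarrow> run_max Z a b \<omega> = max (Z a \<omega>) (run_max Z (Suc a) b \<omega>)"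
proof -
  assume "a < b"
  then have "{a..b} = insert a {Suc a..b}" by auto
  then show ?thesis
    using \<open>a < b\<close> by (simp add: run_max_def)
qed

text \<open>Taken at \<open>c = Z m \<omega>\<close>, the right-hand side is a functional of the
  path restarted at time \<open>m\<close>, to which stationarity applies.\<close>

lemma run_max_shift:
  assumes "n \<ge> 1"
  shows "run_max Z (Suc m) (m + n) \<omega> - c = (MAX k\<in>{1..n}. Z (k + m) \<omega> - c)"
proof -
  have "(\<lambda>k. k + m) ` {1..n} = {Suc m..m + n}"
    by (subst image_add_atLeastAtMost') (simp add: add.commute)
  then have "run_max Z (Suc m) (m + n) \<omega> = (MAX k\<in>{1..n}. Z (k + m) \<omega>)"
    unfolding run_max_def by (simp only: image_image flip: \<open>_ = {Suc m..m + n}\<close>)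
  also have "\<dots> - c = (MAX k\<in>{1..n}. Z (k + m) \<omega> - c)"
    using assms
    by (subst mono_Max_commute[where f = "\<lambda>x. x - c"]) (auto simp: mono_def image_image)
  finally show ?thesis .
qed

lemma run_max_drop_le:
  assumes "n \<ge> 1" and "\<And>j. j \<in> {1..m} \<Longrightarrow> Z j \<omega> - Z (Suc j) \<omega> \<le> c"
  shows "run_max Z 1 (m + n) \<omega> - run_max Z (Suc m) (m + n) \<omega> \<le>
    (\<Sum>j=1..m. if run_max Z (Suc j) (m + n) \<omega> < Z j \<omega> then c else 0)"
proof -
  have "f (Suc 0) - f (Suc k) = (\<Sum>j=1..k. f j - f (Suc j))" for f :: "nat \<Rightarrow> real" and k
    by (induction k) auto
  then have "run_max Z (Suc 0) (m + n) \<omega> - run_max Z (Suc m) (m + n) \<omega> =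
    (\<Sum>j=1..m. run_max Z j (m + n) \<omega> - run_max Z (Suc j) (m + n) \<omega>)" .
  also have "\<dots> \<le> (\<Sum>j=1..m. if run_max Z (Suc j) (m + n) \<omega> < Z j \<omega> then c else 0)"
  proof (rule sum_mono)
    fix j assume j: "j \<in> {1..m}"
    \<comment> \<open>A strict drop at \<open>j\<close> means that \<open>Z j\<close> itself is the
      maximum, so the drop is at most the single decrement \<open>Z j - Z (Suc j)\<close>.
      Positivity of \<open>n\<close> keeps the later window nonempty even for
      \<open>j = m\<close>.\<close>
    have "Z (Suc j) \<omega> \<le> run_max Z (Suc j) (m + n) \<omega>"
      using j assms(1) by (intro run_max_ge) auto
    then show "run_max Z j (m + n) \<omega> - run_max Z (Suc j) (m + n) \<omega> \<le>
        (if run_max Z (Suc j) (m + n) \<omega> < Z j \<omega> then c else 0)"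
      using run_max_rec[of j "m + n" Z \<omega>] j assms by fastforce
  qed
  finally show ?thesis by simp
qed

section \<open>Conditioning on a sub-sigma-algebra\<close>

lemma integrable_indicator_mult:
  fixes f :: "'a \<Rightarrow> real"
  assumes "integrable M f" "A \<in> sets M"
  shows "integrable M (\<lambda>\<omega>. indicator A \<omega> * f \<omega>)"
  using integrable_mult_indicator[OF assms(2,1)] by simp

lemma (in prob_space) integrable_indicator_event:
  "A \<in> events \<Longrightarrow> integrable M (indicator A :: 'a \<Rightarrow> real)"
  by (intro integrable_real_indicator) (auto simp: less_top[symmetric])

text \<open>Integrating the constant conditional law over an event of \<open>F\<close> yields a
  product formula, so \<open>X\<close> is independent of everything measurable with respect to
  \<open>F\<close>.\<close>

lemma (in prob_space) cond_distr_const_indep: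
  assumes sub: "subalgebra M F"
    and X: "cond_distr M F X Q" and Q: "AE \<omega> in M. Q \<omega> = D"
    and [measurable]: "X \<in> borel_measurable M" and H: "H \<in> borel_measurable F"
  shows "indep_var borel H borel X"
proof -
  interpret finite_measure_subalgebra M F
    by unfold_locales (rule sub)
  have FM: "sets F \<subseteq> events" and space: "space F = space M"
    using sub by (auto simp: subalgebra_def)
  have H': "H \<in> borel_measurable M"
    using H sub by (rule measurable_from_subalg[rotated])
  have joint: "prob (A \<inter> (X -` B \<inter> space M)) = prob A * measure D B"
    if A: "A \<in> sets F" and B: "B \<in> sets borel" for A B
  proof -
    let ?C = "X -` B \<inter> space M"
    have C [measurable]: "?C \<in> events" and A' [measurable]: "A \<in> events"
      using A B FM by auto
    have "AE \<omega> in M. real_cond_exp M F (indicator ?C) \<omega> = measure (Q \<omega>) B"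
      using X B by (auto simp: cond_distr_def)
    with Q have AE: "AE \<omega> in M. real_cond_exp M F (indicator ?C) \<omega> = measure D B"
      by eventually_elim simp
    have "prob (A \<inter> ?C) = expectation (\<lambda>\<omega>. indicator A \<omega> * indicator ?C \<omega>)"
      by (simp add: indicator_inter_arith[symmetric])
    also have "\<dots> = expectation (\<lambda>\<omega>. indicator A \<omega> * real_cond_exp M F (indicator ?C) \<omega>)"
    proof (rule real_cond_exp_intg(2)[symmetric])
      show "integrable M (\<lambda>x. indicat_real A x * indicat_real ?C x)"
        by (simp add: indicator_inter_arith[symmetric] less_top[symmetric])
    qed (use A in auto)
    also have "\<dots> = expectation (\<lambda>\<omega>. indicator A \<omega> * measure D B)"
      using AE by (intro integral_cong_AE) (auto elim!: eventually_mono)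
    finally show ?thesis by simp
  qed
  \<comment> \<open>Taking \<open>A\<close> to be the whole space identifies \<open>D\<close> as the
    law of \<open>X\<close>.\<close>
  have marginal: "prob (X -` B \<inter> space M) = measure D B" if "B \<in> sets borel" for B
    using joint[of "space M" B] that space sets.top[of F] by (simp add: prob_space)
  have "sigma_sets (space M) {H -` A \<inter> space M |A. A \<in> sets borel} \<subseteq> sets F"
    using H space by (intro sets.sigma_sets_subset[of _ F, unfolded space]) (auto simp: measurable_def)
  then have HF: "a \<in> sets F" if "a \<in> sigma_sets (space M) {H -` A \<inter> space M |A. A \<in> sets borel}" for a
    using that by blast
  \<comment> \<open>Preimages of Borel sets already form a sigma-algebra, so each generated event is
    itself a preimage and \<open>joint\<close> applies to it.\<close>
  have "sigma_sets (space M) {X -` A \<inter> space M |A. A \<in> sets borel} =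
      {X -` A \<inter> space M |A. A \<in> sets borel}"
    using sets_vimage_algebra[of "space M" X borel] sets_vimage_algebra2[of X "space M" borel] by simp
  then have XB: "\<exists>B\<in>sets borel. b = X -` B \<inter> space M"
    if "b \<in> sigma_sets (space M) {X -` A \<inter> space M |A. A \<in> sets borel}" for b
    using that by blast
  show ?thesis
    unfolding indep_var_eq
  proof (intro conjI indep_setI)
    fix a b
    assume "a \<in> sigma_sets (space M) {H -` A \<inter> space M |A. A \<in> sets borel}"
      and "b \<in> sigma_sets (space M) {X -` A \<inter> space M |A. A \<in> sets borel}"
    with HF[of a] XB[of b] show "prob (a \<inter> b) = prob a * prob b"
      by (metis joint marginal)
  next
    show "sigma_sets (space M) {H -` A \<inter> space M |A. A \<in> sets borel} \<subseteq> events"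
      using HF FM by blast
    show "sigma_sets (space M) {X -` A \<inter> space M |A. A \<in> sets borel} \<subseteq> events"
    proof
      fix b assume "b \<in> sigma_sets (space M) {X -` A \<inter> space M |A. A \<in> sets borel}"
      then obtain B where "B \<in> sets borel" "b = X -` B \<inter> space M"
        using XB by blast
      then show "b \<in> events" by simp
    qed
  qed (use H' in auto)
qed

text \<open>Association is available for bounded functions only, whereas the running maximum is
  unbounded. Clamping to \<open>[- T, T]\<close> preserves monotonicity, and dominated convergence
  with majorant \<open>\<bar>G\<bar>\<close> removes the clamp after integration.\<close>

lemma (in prob_space) cond_assoc_limit:
  assumes sub: "subalgebra M F"
    and [measurable]: "f \<in> borel_measurable M" and f: "\<And>\<omega>. \<bar>f \<omega>\<bar> \<le> (1::real)"
    and G: "integrable M G"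
    and assoc: "\<And>T::nat. AE \<omega> in M.
      real_cond_exp M F (\<lambda>\<omega>. f \<omega> * max (- real T) (min (real T) (G \<omega>))) \<omega> \<ge>
      real_cond_exp M F f \<omega> * real_cond_exp M F (\<lambda>\<omega>. max (- real T) (min (real T) (G \<omega>))) \<omega>"
  shows "expectation (\<lambda>\<omega>. real_cond_exp M F f \<omega> * G \<omega>) \<le> expectation (\<lambda>\<omega>. f \<omega> * G \<omega>)"
proof -
  interpret finite_measure_subalgebra M F
    by unfold_locales (rule sub)
  let ?g = "\<lambda>T \<omega>. max (- real T) (min (real T) (G \<omega>))" and ?H = "real_cond_exp M F f"
  have [measurable]: "G \<in> borel_measurable M" "?H \<in> borel_measurable M"
    using G borel_measurable_cond_exp[of M F f] measurable_from_subalg[OF sub] by auto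
  have int_f: "integrable M f"
    by (rule integrable_const_bound[of _ 1]) (auto simp: f)
  have "AE \<omega> in M. -1 \<le> ?H \<omega>"
    by (rule real_cond_exp_ge_c[OF int_f]) (use f in \<open>auto simp: abs_le_iff minus_le_iff\<close>)
  moreover have "AE \<omega> in M. ?H \<omega> \<le> 1"
    by (rule real_cond_exp_le_c[OF int_f]) (use f in \<open>auto simp: abs_le_iff\<close>)
  ultimately have H: "AE \<omega> in M. \<bar>?H \<omega>\<bar> \<le> 1"
    by eventually_elim auto
  have g_le: "\<bar>?g T \<omega>\<bar> \<le> real T" "\<bar>?g T \<omega>\<bar> \<le> \<bar>G \<omega>\<bar>" for T \<omega>
    by (auto simp: max_def min_def)
  have bound: "\<bar>a * b\<bar> \<le> B" if "\<bar>a\<bar> \<le> 1" "\<bar>b\<bar> \<le> B" for a b B :: real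
    using mult_mono[OF that] by (simp add: abs_mult)
  have le: "expectation (\<lambda>\<omega>. ?H \<omega> * ?g T \<omega>) \<le> expectation (\<lambda>\<omega>. f \<omega> * ?g T \<omega>)" for T
  proof -
    have Hg: "integrable M (\<lambda>\<omega>. ?H \<omega> * ?g T \<omega>)"
    proof (rule integrable_const_bound)
      show "AE \<omega> in M. norm (?H \<omega> * ?g T \<omega>) \<le> real T"
        using H unfolding real_norm_def by eventually_elim (rule bound[OF _ g_le(1)])
    qed measurable
    have fg: "integrable M (\<lambda>\<omega>. f \<omega> * ?g T \<omega>)"
    proof (rule integrable_const_bound)
      show "AE \<omega> in M. norm (f \<omega> * ?g T \<omega>) \<le> real T"
        unfolding real_norm_def by (intro AE_I2 bound[OF f g_le(1)])
    qed measurable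
    \<comment> \<open>Since \<open>?H\<close> is measurable with respect to \<open>F\<close>, the
      conditioning on the other factor disappears under the expectation.\<close>
    note Hg' = real_cond_exp_intg[OF Hg borel_measurable_cond_exp]
    have "expectation (\<lambda>\<omega>. ?H \<omega> * real_cond_exp M F (?g T) \<omega>) \<le>
        expectation (real_cond_exp M F (\<lambda>\<omega>. f \<omega> * ?g T \<omega>))"
      using assoc[of T] by (intro integral_mono_AE real_cond_exp_int(1) fg Hg'(1)) auto
    then show ?thesis
      using real_cond_exp_int(2)[OF fg] Hg'(2) by simp
  qed
  have g_lim: "(\<lambda>T. ?g T \<omega>) \<longlonglongrightarrow> G \<omega>" for \<omega>
  proof (rule tendsto_eventually)
    have "eventually (\<lambda>T. real T \<ge> \<bar>G \<omega>\<bar>) sequentially"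
      using filterlim_real_sequentially by (auto simp: filterlim_at_top)
    then show "eventually (\<lambda>T. ?g T \<omega> = G \<omega>) sequentially"
      by eventually_elim (auto simp: max_def min_def)
  qed
  have "(\<lambda>T. expectation (\<lambda>\<omega>. h \<omega> * ?g T \<omega>)) \<longlonglongrightarrow> expectation (\<lambda>\<omega>. h \<omega> * G \<omega>)"
    if [measurable]: "h \<in> borel_measurable M" and h: "AE \<omega> in M. \<bar>h \<omega>\<bar> \<le> 1" for h
  proof (rule integral_dominated_convergence)
    show "integrable M (\<lambda>\<omega>. \<bar>G \<omega>\<bar>)" using G by simp
    show "AE \<omega> in M. norm (h \<omega> * ?g T \<omega>) \<le> \<bar>G \<omega>\<bar>" for T
      using h unfolding real_norm_def by eventually_elim (rule bound[OF _ g_le(2)])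
    show "AE \<omega> in M. (\<lambda>T. h \<omega> * ?g T \<omega>) \<longlonglongrightarrow> h \<omega> * G \<omega>"
      by (intro AE_I2 tendsto_mult tendsto_const g_lim)
  qed auto
  from LIMSEQ_le[OF this[of ?H] this[of f]] le H f show ?thesis by auto
qed

section \<open>Consequences of stationarity and centering\<close>

locale centered_stationary_increments = prob_space M
  for M :: "'a measure" and Z :: "nat \<Rightarrow> 'a \<Rightarrow> real" +
  assumes Z_measurable [measurable]: "\<And>n. Z n \<in> borel_measurable M"
    and centered: "centered M Z"
    and stationary: "stationary_increments M Z"
begin

lemma integrable_Z [simp]: "integrable M (Z n)"
  and expectation_Z [simp]: "expectation (Z n) = 0"
  using centered by (auto simp: centered_def)

lemma measurable_run_max [measurable]: "run_max Z a b \<in> borel_measurable M"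
  unfolding run_max_def by measurable

lemma integrable_run_max:
  assumes "a \<le> b"
  shows "integrable M (run_max Z a b)"
proof (rule Bochner_Integration.integrable_bound)
  show "integrable M (\<lambda>\<omega>. \<Sum>j=a..b. \<bar>Z j \<omega>\<bar>)" by simp
  show "AE \<omega> in M. norm (run_max Z a b \<omega>) \<le> norm (\<Sum>j=a..b. \<bar>Z j \<omega>\<bar>)"
  proof (rule AE_I2)
    fix \<omega>
    have "run_max Z a b \<omega> \<in> (\<lambda>j. Z j \<omega>) ` {a..b}"
      unfolding run_max_def using assms by (intro Max_in) auto
    then obtain j where "j \<in> {a..b}" "run_max Z a b \<omega> = Z j \<omega>" by auto
    then have "\<bar>run_max Z a b \<omega>\<bar> \<le> (\<Sum>j=a..b. \<bar>Z j \<omega>\<bar>)"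
      using member_le_sum[of j "{a..b}" "\<lambda>j. \<bar>Z j \<omega>\<bar>"] by auto
    then show "norm (run_max Z a b \<omega>) \<le> norm (\<Sum>j=a..b. \<bar>Z j \<omega>\<bar>)" by simp
  qed
qed simp

lemma increments_integral_shift:
  assumes "\<Phi> \<in> borel_measurable (\<Pi>\<^sub>M n\<in>(UNIV :: nat set). borel)"
  shows "expectation (\<lambda>\<omega>. \<Phi> (\<lambda>n. Z (n + k) \<omega> - Z k \<omega>)) =
    (expectation (\<lambda>\<omega>. \<Phi> (\<lambda>n. Z n \<omega>)) :: real)"
proof -
  let ?P = "\<Pi>\<^sub>M n\<in>(UNIV :: nat set). (borel :: real measure)"
  have 1: "(\<lambda>\<omega> n. Z (n + k) \<omega> - Z k \<omega>) \<in> measurable M ?P"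
    by (rule measurable_PiM_single') auto
  have 2: "(\<lambda>\<omega> n. Z n \<omega>) \<in> measurable M ?P"
    by (rule measurable_PiM_single') auto
  have "distr M ?P (\<lambda>\<omega> n. Z (n + k) \<omega> - Z k \<omega>) = distr M ?P (\<lambda>\<omega> n. Z n \<omega>)"
    using stationary unfolding stationary_increments_def by simp
  then show ?thesis
    unfolding integral_distr[OF 1 assms, symmetric] integral_distr[OF 2 assms, symmetric] by (rule arg_cong)
qed

lemma increments_prob_shift:
  assumes "{x. P x} \<in> sets (\<Pi>\<^sub>M n\<in>(UNIV :: nat set). (borel :: real measure))"
  shows "\<P>(\<omega> in M. P (\<lambda>n. Z (n + k) \<omega> - Z k \<omega>)) = \<P>(\<omega> in M. P (\<lambda>n. Z n \<omega>))"
proof -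
  let ?P = "\<Pi>\<^sub>M n\<in>(UNIV :: nat set). (borel :: real measure)"
  have 1: "(\<lambda>\<omega> n. Z (n + k) \<omega> - Z k \<omega>) \<in> measurable M ?P"
    by (rule measurable_PiM_single') auto
  have 2: "(\<lambda>\<omega> n. Z n \<omega>) \<in> measurable M ?P"
    by (rule measurable_PiM_single') auto
  have "measure (distr M ?P (\<lambda>\<omega> n. Z (n + k) \<omega> - Z k \<omega>)) {x. P x} =
      measure (distr M ?P (\<lambda>\<omega> n. Z n \<omega>)) {x. P x}"
    using stationary unfolding stationary_increments_def by simp
  then show ?thesis
    using assms by (simp add: measure_distr[OF 1] measure_distr[OF 2] vimage_def Int_def conj_commute)
qed

text \<open>Subtracting \<open>Z m\<close> turns the maximum into a functional of the restarted path
  and costs nothing in expectation, because \<open>Z m\<close> is centered.\<close>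

lemma expectation_run_max_shift:
  assumes "n \<ge> 1"
  shows "expectation (run_max Z (Suc m) (m + n)) = expectation (run_max Z 1 n)"
proof -
  have "expectation (\<lambda>\<omega>. run_max Z (Suc m) (m + n) \<omega> - Z m \<omega>) =
      expectation (\<lambda>\<omega>. MAX k\<in>{1..n}. Z (k + m) \<omega> - Z m \<omega>)"
    by (simp only: run_max_shift[OF assms])
  also have "\<dots> = expectation (\<lambda>\<omega>. MAX k\<in>{1..n}. Z k \<omega>)"
    by (rule increments_integral_shift) measurable
  also have "\<dots> = expectation (run_max Z 1 n)"
    by (simp add: run_max_def [abs_def])
  finally have "expectation (\<lambda>\<omega>. run_max Z (Suc m) (m + n) \<omega> - Z m \<omega>) =
      expectation (run_max Z 1 n)" .
  then show ?thesis
    using integrable_run_max[of "Suc m" "m + n"] assms by simp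
qed

lemma prob_run_max_shift:
  assumes "n \<ge> 1"
  shows "\<P>(\<omega> in M. run_max Z (Suc m) (m + n) \<omega> < Z m \<omega>) = \<P>(\<omega> in M. run_max Z 1 n \<omega> < 0)"
proof -
  let ?P = "\<Pi>\<^sub>M n\<in>(UNIV :: nat set). (borel :: real measure)"
  have "{x \<in> space ?P. (MAX k\<in>{1..n}. x k) < 0} \<in> sets ?P"
    by measurable
  then have "{x. (MAX k\<in>{1..n}. x k) < (0::real)} \<in> sets ?P"
    by (simp add: space_PiM)
  from increments_prob_shift[OF this, of m] show ?thesis
    using run_max_shift[OF assms, of Z m _ "Z m _", symmetric] by (simp add: run_max_def)
qed

lemma prob_run_max_neg_antimono:
  assumes "1 \<le> n" "n \<le> n'"
  shows "\<P>(\<omega> in M. run_max Z 1 n' \<omega> < 0) \<le> \<P>(\<omega> in M. run_max Z 1 n \<omega> < 0)"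
  using assms by (intro finite_measure_mono) (auto simp: run_max_less_iff)

lemma prob_decrement:
  "\<P>(\<omega> in M. c < Z k \<omega> - Z (Suc k) \<omega>) = \<P>(\<omega> in M. c < - Z 1 \<omega>)"
proof -
  let ?P = "\<Pi>\<^sub>M n\<in>(UNIV :: nat set). (borel :: real measure)"
  have "{x \<in> space ?P. c < - x 1} \<in> sets ?P"
    by measurable
  then have "{x. c < - x 1} \<in> sets ?P"
    by (simp add: space_PiM)
  from increments_prob_shift[OF this, of k] show ?thesis
    by simp
qed

section \<open>Large drops and the growth of the expected maximum\<close>

text \<open>The exceptional event of the argument. The step from time 0 to time 1 is left out
  because the telescoping over shrinking windows starts at time 1.\<close>

definition big_drop :: "nat \<Rightarrow> real \<Rightarrow> 'a set" where
  "big_drop m c = {\<omega> \<in> space M. \<exists>j\<in>{1..m}. c < Z j \<omega> - Z (Suc j) \<omega>}"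

lemma sets_big_drop [measurable]: "big_drop m c \<in> sets M"
  unfolding big_drop_def by measurable

text \<open>The union bound in pointwise form, so that it can be integrated as well as conditioned
  on a sub-sigma-algebra.\<close>

lemma indicator_big_drop_le:
  assumes "\<omega> \<in> space M"
  shows "indicator (big_drop m c) \<omega> \<le>
    (\<Sum>j=1..m. indicator {\<omega> \<in> space M. c < Z j \<omega> - Z (Suc j) \<omega>} \<omega> :: real)"
proof (cases "\<omega> \<in> big_drop m c")
  case True
  then obtain j where "j \<in> {1..m}" "c < Z j \<omega> - Z (Suc j) \<omega>"
    unfolding big_drop_def by auto
  then show ?thesis
    using member_le_sum[of j "{1..m}" "\<lambda>j. indicator {\<omega> \<in> space M. c < Z j \<omega> - Z (Suc j) \<omega>} \<omega> :: real"]
      assms True by simp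
qed (simp add: sum_nonneg)

lemma prob_big_drop_le: "prob (big_drop m c) \<le> m * \<P>(\<omega> in M. c < - Z 1 \<omega>)"
proof -
  have "prob (big_drop m c) = expectation (indicator (big_drop m c))"
    by simp
  also have "\<dots> \<le> expectation
      (\<lambda>\<omega>. \<Sum>j=1..m. indicator {\<omega> \<in> space M. c < Z j \<omega> - Z (Suc j) \<omega>} \<omega> :: real)"
    by (intro integral_mono indicator_big_drop_le Bochner_Integration.integrable_sum
        integrable_indicator_event) measurable
  also have "\<dots> = (\<Sum>j=1..m. \<P>(\<omega> in M. c < Z j \<omega> - Z (Suc j) \<omega>))"
    by (subst Bochner_Integration.integral_sum) (auto intro!: sum.cong integrable_indicator_event)
  finally show ?thesis
    by (simp add: prob_decrement)
qed

lemma expectation_drop_le: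
  assumes "n \<ge> 1" "c \<ge> 0"
  shows "expectation (\<lambda>\<omega>. (1 - indicator (big_drop m c) \<omega>) *
      (run_max Z 1 (m + n) \<omega> - run_max Z (Suc m) (m + n) \<omega>))
    \<le> m * c * \<P>(\<omega> in M. run_max Z 1 n \<omega> < 0)" (is "expectation ?L \<le> _")
proof -
  let ?D = "\<lambda>j. {\<omega> \<in> space M. run_max Z (Suc j) (m + n) \<omega> < Z j \<omega>}"
  have "expectation ?L \<le> expectation (\<lambda>\<omega>. \<Sum>j=1..m. c * indicator (?D j) \<omega>)"
  proof (rule integral_mono)
    have "integrable M (\<lambda>\<omega>. run_max Z 1 (m + n) \<omega> - run_max Z (Suc m) (m + n) \<omega>)"
      using assms by (intro Bochner_Integration.integrable_diff integrable_run_max) auto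
    then show "integrable M ?L"
      by (rule Bochner_Integration.integrable_bound) (auto simp: indicator_def)
    show "integrable M (\<lambda>\<omega>. \<Sum>j=1..m. c * indicator (?D j) \<omega>)"
      by (intro Bochner_Integration.integrable_sum integrable_mult_right
          integrable_indicator_event) measurable
    show "?L \<omega> \<le> (\<Sum>j=1..m. c * indicator (?D j) \<omega>)" if "\<omega> \<in> space M" for \<omega>
    proof (cases "\<omega> \<in> big_drop m c")
      case False
      then have "\<And>j. j \<in> {1..m} \<Longrightarrow> Z j \<omega> - Z (Suc j) \<omega> \<le> c"
        using that unfolding big_drop_def by (auto simp: not_less)
      from run_max_drop_le[of n m Z \<omega> c, OF assms(1) this] have "?L \<omega> \<le>
          (\<Sum>j=1..m. if run_max Z (Suc j) (m + n) \<omega> < Z j \<omega> then c else 0)"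
        using False by simp
      also have "\<dots> = (\<Sum>j=1..m. c * indicator (?D j) \<omega>)"
        using that by (intro sum.cong) auto
      finally show ?thesis .
    qed (auto intro!: sum_nonneg mult_nonneg_nonneg assms)
  qed
  also have "\<dots> = (\<Sum>j=1..m. c * prob (?D j))"
    by (subst Bochner_Integration.integral_sum) (auto intro!: sum.cong integrable_indicator_event)
  also have "\<dots> \<le> (\<Sum>j=1..m. c * \<P>(\<omega> in M. run_max Z 1 n \<omega> < 0))"
  proof (intro sum_mono mult_left_mono)
    fix j assume j: "j \<in> {1..m}"
    \<comment> \<open>After time \<open>j\<close> there remain \<open>m + n - j \<ge> n\<close>
      steps, and staying negative for longer is less likely.\<close>
    have "prob (?D j) = \<P>(\<omega> in M. run_max Z 1 (m + n - j) \<omega> < 0)"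
    proof -
      have "m + n - j \<ge> 1" "j + (m + n - j) = m + n"
        using j assms(1) by auto
      then show ?thesis
        using prob_run_max_shift[of "m + n - j" j] by simp
    qed
    also have "\<dots> \<le> \<P>(\<omega> in M. run_max Z 1 n \<omega> < 0)"
      using j assms(1) by (intro prob_run_max_neg_antimono) auto
    finally show "prob (?D j) \<le> \<P>(\<omega> in M. run_max Z 1 n \<omega> < 0)" .
  qed (use assms in auto)
  finally show ?thesis by simp
qed

text \<open>Stationarity at \<open>k = 0\<close> says that the path minus its initial value has the
  law of the path itself, and the former vanishes at time 0.\<close>

lemma AE_Z_0: "AE \<omega> in M. Z 0 \<omega> = 0"
proof -
  let ?P = "\<Pi>\<^sub>M n\<in>(UNIV :: nat set). (borel :: real measure)"
  have "{x \<in> space ?P. x 0 = 0} \<in> sets ?P"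
    by measurable
  then have "{x. x 0 = (0::real)} \<in> sets ?P"
    by (simp add: space_PiM)
  from increments_prob_shift[OF this, of 0] have "\<P>(\<omega> in M. Z 0 \<omega> = 0) = 1"
    by (simp add: prob_space)
  then show ?thesis
    by (subst (asm) prob_Collect_eq_1) auto
qed

lemma expectation_run_max_nonneg:
  assumes "n \<ge> 1"
  shows "expectation (run_max Z 1 n) \<ge> 0"
proof -
  have "expectation (Z 1) \<le> expectation (run_max Z 1 n)"
    using assms by (intro integral_mono integrable_run_max run_max_ge) auto
  then show ?thesis by simp
qed

lemma expectation_run_max_drop:
  assumes "n \<ge> 1"
  shows "integrable M (\<lambda>\<omega>. run_max Z 1 (m + n) \<omega> - run_max Z (Suc m) (m + n) \<omega>)"
    and "expectation (\<lambda>\<omega>. run_max Z 1 (m + n) \<omega> - run_max Z (Suc m) (m + n) \<omega>) =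
      expectation (run_max Z 1 (m + n)) - expectation (run_max Z 1 n)"
  using assms integrable_run_max[of 1 "m + n"] integrable_run_max[of "Suc m" "m + n"]
  by (simp_all add: expectation_run_max_shift)

text \<open>The drop of the maximum is split along \<open>big_drop\<close>. The part on this event
  remains as an error term, which vanishes for bounded decrements and is estimated by a moment under
  the Lp hypothesis.\<close>

lemma expectation_run_max_drop_le:
  assumes "n \<ge> 1" "c \<ge> 0"
  shows "expectation (run_max Z 1 (m + n)) - expectation (run_max Z 1 n) \<le>
    m * c * \<P>(\<omega> in M. run_max Z 1 n \<omega> < 0) +
    expectation (\<lambda>\<omega>. indicator (big_drop m c) \<omega> *
      (run_max Z 1 (m + n) \<omega> - run_max Z (Suc m) (m + n) \<omega>))"
proof -
  let ?D = "\<lambda>\<omega>. run_max Z 1 (m + n) \<omega> - run_max Z (Suc m) (m + n) \<omega>"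
  have D: "integrable M ?D"
    using assms by (intro expectation_run_max_drop) auto
  have "expectation ?D =
      expectation (\<lambda>\<omega>. (1 - indicator (big_drop m c) \<omega>) * ?D \<omega>) +
      expectation (\<lambda>\<omega>. indicator (big_drop m c) \<omega> * ?D \<omega>)"
    using D integrable_indicator_mult[OF D sets_big_drop]
    by (simp add: left_diff_distrib)
  then show ?thesis
    using expectation_drop_le[OF assms, of m] expectation_run_max_drop(2)[OF assms(1), of m] by simp
qed

text \<open>Decrements above \<open>b\<close> are null events, so the error term vanishes;
  \<open>b\<close> is nonnegative because it dominates the centered variable \<open>- Z 1\<close>
  almost surely.\<close>

lemma expectation_run_max_drop_le_bounded:
  assumes "n \<ge> 1" "\<P>(\<omega> in M. - Z 1 \<omega> \<le> b) = 1"
  shows "expectation (run_max Z 1 (m + n)) - expectation (run_max Z 1 n) \<le>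
    m * b * \<P>(\<omega> in M. run_max Z 1 n \<omega> < 0)" and "b \<ge> 0"
proof -
  have AE: "AE \<omega> in M. - Z 1 \<omega> \<le> b"
    using assms(2) by (subst (asm) prob_Collect_eq_1) auto
  then have "expectation (\<lambda>\<omega>. - Z 1 \<omega>) \<le> expectation (\<lambda>\<omega>. b)"
    by (intro integral_mono_AE) auto
  then show "b \<ge> 0"
    by (simp add: prob_space)
  have "\<P>(\<omega> in M. b < - Z 1 \<omega>) = 0"
    using AE by (intro prob_eq_0[THEN iffD2]) (auto simp: not_less elim!: eventually_mono)
  then have "prob (big_drop m b) = 0"
    using prob_big_drop_le[of m b] by (simp add: measure_le_0_iff)
  then have "AE \<omega> in M. \<omega> \<notin> big_drop m b"
    by (subst (asm) prob_eq_0) auto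
  then have "expectation (\<lambda>\<omega>. indicator (big_drop m b) \<omega> *
      (run_max Z 1 (m + n) \<omega> - run_max Z (Suc m) (m + n) \<omega>)) = expectation (\<lambda>\<omega>. 0)"
    by (intro integral_cong_AE) (auto elim!: eventually_mono)
  then show "expectation (run_max Z 1 (m + n)) - expectation (run_max Z 1 n) \<le>
    m * b * \<P>(\<omega> in M. run_max Z 1 n \<omega> < 0)"
    using expectation_run_max_drop_le[OF assms(1) \<open>b \<ge> 0\<close>, of m] by simp
qed

text \<open>Instead of Hoelder's inequality we use \<open>y \<le> a + a\<^bsup>1-p\<^esup> y\<^sup>p\<close> for \<open>y \<ge> 0\<close>.\<close>

lemma expectation_big_drop_Lp_le:
  fixes p a :: real
  assumes "n \<ge> 1" "p > 1" "a > 0"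
    and int: "integrable M (\<lambda>\<omega>. \<bar>run_max Z 1 (m + n) \<omega> - Z (m + n) \<omega>\<bar> powr p)"
  shows "expectation (\<lambda>\<omega>. indicator (big_drop m c) \<omega> *
      (run_max Z 1 (m + n) \<omega> - run_max Z (Suc m) (m + n) \<omega>)) \<le>
    a * prob (big_drop m c) +
    a powr (1 - p) * expectation (\<lambda>\<omega>. \<bar>run_max Z 1 (m + n) \<omega> - Z (m + n) \<omega>\<bar> powr p)"
    (is "expectation ?L \<le> _")
proof -
  let ?Y = "\<lambda>\<omega>. \<bar>run_max Z 1 (m + n) \<omega> - Z (m + n) \<omega>\<bar>"
  have ind: "integrable M (indicator (big_drop m c) :: 'a \<Rightarrow> real)"
    by (intro integrable_indicator_event) simp
  have "expectation ?L \<le>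
      expectation (\<lambda>\<omega>. a * indicator (big_drop m c) \<omega> + a powr (1 - p) * ?Y \<omega> powr p)"
  proof (rule integral_mono)
    show "integrable M ?L"
      using assms by (intro integrable_indicator_mult expectation_run_max_drop) auto
    show "integrable M (\<lambda>\<omega>. a * indicator (big_drop m c) \<omega> + a powr (1 - p) * ?Y \<omega> powr p)"
      using int ind by simp
    fix \<omega>
    have "Z (m + n) \<omega> \<le> run_max Z (Suc m) (m + n) \<omega>"
      using assms(1) by (intro run_max_ge) auto
    then have le: "run_max Z 1 (m + n) \<omega> - run_max Z (Suc m) (m + n) \<omega> \<le> ?Y \<omega>"
      by simp
    show "?L \<omega> \<le> a * indicator (big_drop m c) \<omega> + a powr (1 - p) * ?Y \<omega> powr p"
    \<comment> \<open>Above level \<open>a\<close> the negative exponent \<open>1 - p\<close> gives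
      the bound. Otherwise either the indicator vanishes or the first summand alone
      suffices.\<close>
    proof (cases "\<omega> \<in> big_drop m c \<and> a < ?Y \<omega>")
      case True
      then have "?Y \<omega> = ?Y \<omega> powr (1 - p) * ?Y \<omega> powr p"
        using assms(3) by (simp add: powr_add[symmetric])
      also have "\<dots> \<le> a powr (1 - p) * ?Y \<omega> powr p"
        using True assms by (intro mult_right_mono powr_mono2') auto
      finally show ?thesis
        using le True assms(3) by simp
    next
      case False
      then show ?thesis
        using le by (auto simp: not_less indicator_def intro!: add_increasing2)
    qed
  qed
  also have "\<dots> = a * prob (big_drop m c) + a powr (1 - p) * expectation (\<lambda>\<omega>. ?Y \<omega> powr p)"
    using int ind by simp
  finally show ?thesis .
qed

section \<open>Association and the exceptional event\<close>

text \<open>Both factors are nondecreasing in the increments: raising increments cannot create a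
  large drop, and \<open>G\<close> is a maximum of partial sums. \<open>Z 0\<close> is subtracted
  because the increments determine the path only up to its initial value.\<close>

lemma pos_assoc_big_drop:
  fixes m n :: nat and c :: real
  assumes sub: "subalgebra M F" and assoc: "pos_assoc_increments_given M F Z" and n: "n \<ge> 1"
  defines "G \<equiv> \<lambda>\<omega>. run_max Z 1 (m + n) \<omega> - Z 0 \<omega>"
    and "f \<equiv> \<lambda>\<omega>. 1 - indicat_real (big_drop m c) \<omega>"
  shows "expectation (\<lambda>\<omega>. real_cond_exp M F f \<omega> * G \<omega>) \<le> expectation (\<lambda>\<omega>. f \<omega> * G \<omega>)"
proof (rule cond_assoc_limit[OF sub])
  interpret finite_measure_subalgebra M F
    by unfold_locales (rule sub)
  show [measurable]: "f \<in> borel_measurable M"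
    by (simp add: f_def)
  show "\<bar>f \<omega>\<bar> \<le> 1" for \<omega>
    by (simp add: f_def indicator_def)
  show "integrable M G"
    using n by (simp add: G_def integrable_run_max)
  then have [measurable]: "G \<in> borel_measurable M" by auto
  fix T :: nat
  let ?N = "m + n" and ?g = "\<lambda>\<omega>. max (- real T) (min (real T) (G \<omega>))"
  let ?P = "\<Pi>\<^sub>M i\<in>{..<m + n}. (borel :: real measure)"
  \<comment> \<open>\<open>\<phi>\<close> and \<open>\<psi>\<close> express \<open>f\<close> and the
    clamped \<open>G\<close> through the increment vector. Coordinate \<open>j\<close> is
    \<open>Z (Suc j) - Z j\<close>, so a decrement of at most \<open>c\<close> reads
    \<open>- c \<le> x j\<close>; the index \<open>j = m\<close> lies inside
    \<open>{..<m + n}\<close> since \<open>n \<ge> 1\<close>.\<close>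
  define \<phi> where "\<phi> x = (if \<forall>j\<in>{1..m}. - c \<le> x j then 1 else 0 :: real)" for x :: "nat \<Rightarrow> real"
  define \<psi> where "\<psi> x = max (- real T) (min (real T) (MAX k\<in>{1..?N}. \<Sum>i<k. x i))" for x :: "nat \<Rightarrow> real"
  have \<phi>: "\<phi> (increments Z ?N \<omega>) = f \<omega>" if "\<omega> \<in> space M" for \<omega>
  proof -
    have "(\<forall>j\<in>{1..m}. - c \<le> increments Z ?N \<omega> j) \<longleftrightarrow> \<omega> \<notin> big_drop m c"
      using n that by (force simp: big_drop_def increments_def not_less)
    then show ?thesis
      by (simp add: \<phi>_def f_def)
  qed
  have \<psi>: "\<psi> (increments Z ?N \<omega>) = ?g \<omega>" for \<omega>
  proof -
    have "(\<Sum>i<k. increments Z ?N \<omega> i) = Z k \<omega> - Z 0 \<omega>" if "k \<in> {1..?N}" for k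
    proof -
      have "(\<Sum>i<k. increments Z ?N \<omega> i) = (\<Sum>i<k. Z (Suc i) \<omega> - Z i \<omega>)"
        using that by (intro sum.cong) (auto simp: increments_def)
      also have "\<dots> = Z k \<omega> - Z 0 \<omega>"
        by (rule sum_lessThan_telescope)
      finally show ?thesis .
    qed
    then have "(MAX k\<in>{1..?N}. \<Sum>i<k. increments Z ?N \<omega> i) = (MAX k\<in>{1..?N}. Z k \<omega> - Z 0 \<omega>)"
      by (intro arg_cong[where f = Max] image_cong) auto
    also have "\<dots> = G \<omega>"
      using run_max_shift[of ?N Z 0 \<omega> "Z 0 \<omega>"] n by (simp add: G_def)
    finally show ?thesis by (simp add: \<psi>_def)
  qed
  have "test_fun ?N \<phi>"
    unfolding test_fun_def
  proof (intro conjI)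
    have "{x \<in> space ?P. \<forall>j\<in>{1..m}. - c \<le> x j} \<in> sets ?P"
      using n by (intro sets.sets_Collect_finite_All) (auto intro!: borel_measurable_le measurable_component_singleton)
    then show "\<phi> \<in> borel_measurable ?P"
      unfolding \<phi>_def by (intro measurable_If) auto
    show "bounded (\<phi> ` space ?P)"
      by (rule boundedI[of _ 1]) (auto simp: \<phi>_def)
    show "mono_on (space ?P) \<phi>"
      by (intro mono_onI) (auto simp: \<phi>_def le_fun_def intro: order_trans)
  qed
  moreover have "test_fun ?N \<psi>"
    unfolding test_fun_def
  proof (intro conjI)
    show "\<psi> \<in> borel_measurable ?P"
      unfolding \<psi>_def
      by (intro borel_measurable_max borel_measurable_min borel_measurable_const borel_measurable_Max
          borel_measurable_sum measurable_component_singleton) auto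
    show "bounded (\<psi> ` space ?P)"
      by (rule boundedI[of _ "real T"]) (auto simp: \<psi>_def)
    have "(MAX k\<in>{1..?N}. \<Sum>i<k. x i) \<le> (MAX k\<in>{1..?N}. \<Sum>i<k. y i)"
      if "x \<le> y" for x y :: "nat \<Rightarrow> real"
    proof (rule Max.boundedI)
      fix a assume "a \<in> (\<lambda>k. \<Sum>i<k. x i) ` {1..?N}"
      then obtain k where "k \<in> {1..?N}" "a = (\<Sum>i<k. x i)" by auto
      moreover have "(\<Sum>i<k. x i) \<le> (\<Sum>i<k. y i)"
        using that by (intro sum_mono) (auto simp: le_fun_def)
      ultimately show "a \<le> (MAX k\<in>{1..?N}. \<Sum>i<k. y i)"
        by (auto intro!: Max_ge_iff[THEN iffD2])
    qed (use n in auto)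
    then show "mono_on (space ?P) \<psi>"
      unfolding \<psi>_def by (intro mono_onI max.mono min.mono order_refl)
  qed
  ultimately have "AE \<omega> in M.
     real_cond_exp M F (\<lambda>\<omega>. \<phi> (increments Z ?N \<omega>) * \<psi> (increments Z ?N \<omega>)) \<omega> \<ge>
     real_cond_exp M F (\<lambda>\<omega>. \<phi> (increments Z ?N \<omega>)) \<omega> *
     real_cond_exp M F (\<lambda>\<omega>. \<psi> (increments Z ?N \<omega>)) \<omega>"
    using assoc unfolding pos_assoc_increments_given_def by blast
  moreover have "AE \<omega> in M. real_cond_exp M F (\<lambda>\<omega>. \<phi> (increments Z ?N \<omega>) * \<psi> (increments Z ?N \<omega>)) \<omega> =
      real_cond_exp M F (\<lambda>\<omega>. f \<omega> * ?g \<omega>) \<omega>"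
  proof (rule real_cond_exp_cong)
    show "AE \<omega> in M. \<phi> (increments Z ?N \<omega>) * \<psi> (increments Z ?N \<omega>) = f \<omega> * ?g \<omega>"
      by (rule AE_I2) (simp add: \<phi> \<psi>)
    show "(\<lambda>\<omega>. \<phi> (increments Z ?N \<omega>) * \<psi> (increments Z ?N \<omega>)) \<in> borel_measurable M"
      by (subst measurable_cong[where g = "\<lambda>\<omega>. f \<omega> * ?g \<omega>"]) (simp_all add: \<phi> \<psi>)
  qed simp
  moreover have "AE \<omega> in M. real_cond_exp M F (\<lambda>\<omega>. \<phi> (increments Z ?N \<omega>)) \<omega> = real_cond_exp M F f \<omega>"
  proof (rule real_cond_exp_cong)
    show "AE \<omega> in M. \<phi> (increments Z ?N \<omega>) = f \<omega>"
      by (rule AE_I2) (simp add: \<phi>)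
    show "(\<lambda>\<omega>. \<phi> (increments Z ?N \<omega>)) \<in> borel_measurable M"
      by (subst measurable_cong[where g = f]) (simp_all add: \<phi>)
  qed simp
  ultimately show "AE \<omega> in M. real_cond_exp M F f \<omega> * real_cond_exp M F ?g \<omega> \<le>
      real_cond_exp M F (\<lambda>\<omega>. f \<omega> * ?g \<omega>) \<omega>"
    by eventually_elim (simp add: \<psi>)
qed

text \<open>The union bound conditionally on \<open>F\<close>: each decrement exceeds
  \<open>c\<close> with the same conditional as unconditional probability, so the bound is a
  constant that holds almost surely.\<close>

lemma cond_prob_big_drop_le:
  assumes sub: "subalgebra M F" and distr: "cond_distr_increments_indep M F Z"
  shows "AE \<omega> in M. 1 - m * \<P>(\<omega> in M. c < - Z 1 \<omega>) \<le>
    real_cond_exp M F (\<lambda>\<omega>. 1 - indicat_real (big_drop m c) \<omega>) \<omega>"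
proof -
  interpret finite_measure_subalgebra M F
    by unfold_locales (rule sub)
  let ?A = "\<lambda>j. {\<omega> \<in> space M. c < Z j \<omega> - Z (Suc j) \<omega>}"
  have A: "integrable M (indicat_real (?A j))" for j
    by (rule integrable_indicator_event) measurable
  have "AE \<omega> in M. real_cond_exp M F (indicator (?A j)) \<omega> = \<P>(\<omega> in M. c < - Z 1 \<omega>)" for j
  proof -
    obtain Q where Q: "cond_distr M F (\<lambda>\<omega>. Z (Suc j) \<omega> - Z j \<omega>) Q" "AE \<omega> in M. Q \<omega> = distr M borel (Z 1)"
      using distr[unfolded cond_distr_increments_indep_def, rule_format, of "Suc j"] by auto
    have "(\<lambda>\<omega>. Z (Suc j) \<omega> - Z j \<omega>) -` {..<- c} \<inter> space M = ?A j"
      by auto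
    with Q(1) have "AE \<omega> in M. real_cond_exp M F (indicator (?A j)) \<omega> = measure (Q \<omega>) {..<- c}"
      unfolding cond_distr_def by (metis lessThan_borel)
    with Q(2) have "AE \<omega> in M. real_cond_exp M F (indicator (?A j)) \<omega> = measure (distr M borel (Z 1)) {..<- c}"
      by eventually_elim simp
    moreover have "measure (distr M borel (Z 1)) {..<- c} = \<P>(\<omega> in M. c < - Z 1 \<omega>)"
      by (subst measure_distr) (auto intro!: arg_cong[where f = prob])
    ultimately show ?thesis by simp
  qed
  then have "AE \<omega> in M. \<forall>j. real_cond_exp M F (indicator (?A j)) \<omega> = \<P>(\<omega> in M. c < - Z 1 \<omega>)"
    by (simp add: AE_all_countable)
  moreover have "AE \<omega> in M. real_cond_exp M F (\<lambda>\<omega>. \<Sum>j=1..m. indicator (?A j) \<omega>) \<omega> =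
      (\<Sum>j=1..m. real_cond_exp M F (indicator (?A j)) \<omega>)"
    by (rule real_cond_exp_sum) (rule A)
  moreover have "AE \<omega> in M. real_cond_exp M F (\<lambda>\<omega>. 1 - (\<Sum>j=1..m. indicator (?A j) \<omega>)) \<omega> =
      real_cond_exp M F (\<lambda>\<omega>. 1) \<omega> - real_cond_exp M F (\<lambda>\<omega>. \<Sum>j=1..m. indicator (?A j) \<omega>) \<omega>"
    by (intro real_cond_exp_diff Bochner_Integration.integrable_sum A) simp
  moreover have "AE \<omega> in M. real_cond_exp M F (\<lambda>\<omega>. 1) \<omega> = 1"
    by (rule real_cond_exp_F_meas) auto
  moreover have "AE \<omega> in M. real_cond_exp M F (\<lambda>\<omega>. 1 - (\<Sum>j=1..m. indicator (?A j) \<omega>)) \<omega> \<le>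
      real_cond_exp M F (\<lambda>\<omega>. 1 - indicat_real (big_drop m c) \<omega>) \<omega>"
  proof (rule real_cond_exp_mono)
    show "AE \<omega> in M. 1 - (\<Sum>j=1..m. indicat_real (?A j) \<omega>) \<le> 1 - indicat_real (big_drop m c) \<omega>"
      using indicator_big_drop_le[of _ m c] by (intro AE_I2) simp
  qed (intro Bochner_Integration.integrable_diff Bochner_Integration.integrable_sum A
      integrable_indicator_event integrable_const sets_big_drop)+
  ultimately show ?thesis
    by eventually_elim simp
qed

text \<open>\<open>Z 1\<close> is split off the maximum because only the nonnegative rest can be bounded using
  the estimate of the conditional probability of a large drop; \<open>Z 1\<close> itself is centered and
  independent of \<open>F\<close>.\<close>

lemma expectation_big_drop_assoc_le:
  assumes sub: "subalgebra M F" and assoc: "pos_assoc_increments_given M F Z"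
    and distr: "cond_distr_increments_indep M F Z" and n: "n \<ge> 1"
  shows "expectation (\<lambda>\<omega>. indicator (big_drop m c) \<omega> * run_max Z 1 (m + n) \<omega>) \<le>
    m * \<P>(\<omega> in M. c < - Z 1 \<omega>) * expectation (run_max Z 1 (m + n))"
proof -
  interpret finite_measure_subalgebra M F
    by unfold_locales (rule sub)
  define f where "f = (\<lambda>\<omega>. 1 - indicat_real (big_drop m c) \<omega>)"
  define G where "G = (\<lambda>\<omega>. run_max Z 1 (m + n) \<omega> - Z 0 \<omega>)"
  define X where "X = (\<lambda>\<omega>. Z 1 \<omega> - Z 0 \<omega>)"
  define \<delta> where "\<delta> = m * \<P>(\<omega> in M. c < - Z 1 \<omega>)"
  let ?H = "real_cond_exp M F f"
  have G: "integrable M G"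
    using n by (simp add: G_def integrable_run_max)
  have X: "integrable M X" "expectation X = 0"
    by (simp_all add: X_def)
  have f: "integrable M f"
    unfolding f_def by (intro Bochner_Integration.integrable_diff integrable_indicator_event) auto
  have XG: "X \<omega> \<le> G \<omega>" for \<omega>
    using n run_max_ge[of 1 1 "m + n" Z \<omega>] by (simp add: X_def G_def)
  have [measurable]: "G \<in> borel_measurable M" "X \<in> borel_measurable M" "f \<in> borel_measurable M"
      "?H \<in> borel_measurable M"
    using G X f real_cond_exp_int(1)[OF f] by auto
  have "AE \<omega> in M. ?H \<omega> \<le> 1"
    by (rule real_cond_exp_le_c[OF f]) (simp add: f_def)
  moreover have "AE \<omega> in M. 0 \<le> ?H \<omega>"
    by (rule real_cond_exp_ge_c[OF f]) (simp add: f_def indicator_def)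
  ultimately have H01: "AE \<omega> in M. \<bar>1 - ?H \<omega>\<bar> \<le> 1"
    by eventually_elim simp
  have H: "AE \<omega> in M. 1 - ?H \<omega> \<le> \<delta>"
    using cond_prob_big_drop_le[OF sub distr, of m c] by (auto simp: \<delta>_def f_def elim!: eventually_mono)
  have int: "integrable M (\<lambda>\<omega>. (1 - ?H \<omega>) * Y \<omega>)" if "integrable M Y" for Y
  proof (rule Bochner_Integration.integrable_bound[OF that])
    show "AE \<omega> in M. norm ((1 - ?H \<omega>) * Y \<omega>) \<le> norm (Y \<omega>)"
      using H01 by eventually_elim (auto simp: abs_mult intro!: mult_left_le_one_le)
  qed (use that in auto)
  have indep: "expectation (\<lambda>\<omega>. (1 - ?H \<omega>) * X \<omega>) = 0"
  proof -
    obtain Q where Q: "cond_distr M F (\<lambda>\<omega>. Z 1 \<omega> - Z 0 \<omega>) Q" "AE \<omega> in M. Q \<omega> = distr M borel (Z 1)"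
      using distr[unfolded cond_distr_increments_indep_def, rule_format, of 1] by auto
    have "indep_var borel (\<lambda>\<omega>. 1 - ?H \<omega>) borel X"
      using Q(1) unfolding X_def by (intro cond_distr_const_indep[OF sub _ Q(2)]) auto
    from indep_var_lebesgue_integral[OF this] show ?thesis
      using X real_cond_exp_int(1)[OF f] by simp
  qed
  have fG: "integrable M (\<lambda>\<omega>. f \<omega> * G \<omega>)"
    by (rule Bochner_Integration.integrable_bound[OF G])
      (auto simp: f_def indicator_def)
  have HG: "integrable M (\<lambda>\<omega>. ?H \<omega> * G \<omega>)"
    using Bochner_Integration.integrable_diff[OF G int[OF G]] by (simp add: left_diff_distrib)
  \<comment> \<open>\<open>Z 0\<close> vanishes almost surely, so \<open>G\<close> may replace the
    maximum, and the indicator is \<open>1 - f\<close>.\<close>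
  have "expectation (\<lambda>\<omega>. indicator (big_drop m c) \<omega> * run_max Z 1 (m + n) \<omega>) =
      expectation (\<lambda>\<omega>. G \<omega> - f \<omega> * G \<omega>)"
    using AE_Z_0 by (intro integral_cong_AE) (auto simp: f_def G_def left_diff_distrib elim!: eventually_mono)
  also have "\<dots> = expectation G - expectation (\<lambda>\<omega>. f \<omega> * G \<omega>)"
    using G fG by simp
  also have "\<dots> \<le> expectation G - expectation (\<lambda>\<omega>. ?H \<omega> * G \<omega>)"
    using pos_assoc_big_drop[OF sub assoc n, of m c] unfolding f_def G_def by simp
  also have "\<dots> = expectation (\<lambda>\<omega>. (1 - ?H \<omega>) * (G \<omega> - X \<omega>)) + expectation (\<lambda>\<omega>. (1 - ?H \<omega>) * X \<omega>)"
    using G HG int[OF G] int[OF X(1)] by (simp add: left_diff_distrib right_diff_distrib)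
  also have "expectation (\<lambda>\<omega>. (1 - ?H \<omega>) * (G \<omega> - X \<omega>)) \<le> expectation (\<lambda>\<omega>. \<delta> * (G \<omega> - X \<omega>))"
    using H G X by (intro integral_mono_AE int) (auto elim!: eventually_mono intro!: mult_right_mono XG)
  \<comment> \<open>\<open>G - X\<close> is the maximum minus the centered variable
    \<open>Z 1\<close>.\<close>
  also have "\<dots> = \<delta> * expectation (run_max Z 1 (m + n))"
    using G X n by (simp add: G_def integrable_run_max)
  finally show ?thesis
    by (simp add: indep \<delta>_def)
qed

text \<open>Passing from \<open>Z (Suc m)\<close> up to the maximum raises the positive part by at
  most their difference, whose mean is that of the maximum over \<open>n\<close> steps. This serves
  the simpler criterion for \<open>star_condition\<close>.\<close>

lemma expectation_max_0_run_max_le: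
  assumes "n \<ge> 1"
  shows "expectation (\<lambda>\<omega>. max 0 (run_max Z (Suc m) (m + n) \<omega>)) \<le>
    expectation (\<lambda>\<omega>. max 0 (Z (Suc m) \<omega>)) + expectation (run_max Z 1 n)"
proof -
  have int: "integrable M (run_max Z (Suc m) (m + n))"
    using assms by (intro integrable_run_max) auto
  have "expectation (\<lambda>\<omega>. max 0 (run_max Z (Suc m) (m + n) \<omega>)) \<le>
      expectation (\<lambda>\<omega>. max 0 (Z (Suc m) \<omega>) + (run_max Z (Suc m) (m + n) \<omega> - Z (Suc m) \<omega>))"
  proof (rule integral_mono)
    fix \<omega>
    have "Z (Suc m) \<omega> \<le> run_max Z (Suc m) (m + n) \<omega>"
      using assms by (intro run_max_ge) auto
    then show "max 0 (run_max Z (Suc m) (m + n) \<omega>) \<le>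
        max 0 (Z (Suc m) \<omega>) + (run_max Z (Suc m) (m + n) \<omega> - Z (Suc m) \<omega>)"
      by (simp add: max_def)
  qed (use int in auto)
  also have "\<dots> = expectation (\<lambda>\<omega>. max 0 (Z (Suc m) \<omega>)) + expectation (run_max Z 1 n)"
    using int expectation_run_max_shift[OF assms, of m] by simp
  finally show ?thesis .
qed

text \<open>On the exceptional event all of \<open>?S\<close> is kept: the difference
  \<open>?S - ?T\<close> is nonincreasing in the increments, like the event itself, so association
  gives it no upper bound. The price is the term \<open>?T\<close> on the complement, bounded by the
  positive part that occurs in \<open>star_condition\<close>.\<close>

lemma expectation_run_max_assoc_le:
  assumes sub: "subalgebra M F" and assoc: "pos_assoc_increments_given M F Z"
    and distr: "cond_distr_increments_indep M F Z" and n: "n \<ge> 1" and c: "c \<ge> 0"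
  shows "(1 - m * \<P>(\<omega> in M. c < - Z 1 \<omega>)) * expectation (run_max Z 1 (m + n)) \<le>
    m * c * \<P>(\<omega> in M. run_max Z 1 n \<omega> < 0) +
    expectation (\<lambda>\<omega>. max 0 (run_max Z (Suc m) (m + n) \<omega>))"
proof -
  let ?I = "\<lambda>\<omega>. indicat_real (big_drop m c) \<omega>"
  let ?S = "run_max Z 1 (m + n)" and ?T = "run_max Z (Suc m) (m + n)"
  have S: "integrable M ?S" and T: "integrable M ?T"
    using n by (auto intro!: integrable_run_max)
  note IS = integrable_indicator_mult[OF S sets_big_drop, of m c]
  note IT = integrable_indicator_mult[OF T sets_big_drop, of m c]
  have "expectation (\<lambda>\<omega>. (1 - ?I \<omega>) * ?T \<omega>) \<le> expectation (\<lambda>\<omega>. max 0 (?T \<omega>))"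
  proof (rule integral_mono)
    show "integrable M (\<lambda>\<omega>. (1 - ?I \<omega>) * ?T \<omega>)"
      using T IT by (simp add: left_diff_distrib)
    show "integrable M (\<lambda>\<omega>. max 0 (?T \<omega>))"
      using T by simp
  qed (simp add: indicator_def)
  moreover have "expectation (\<lambda>\<omega>. (1 - ?I \<omega>) * (?S \<omega> - ?T \<omega>)) \<le>
      m * c * \<P>(\<omega> in M. run_max Z 1 n \<omega> < 0)"
    by (rule expectation_drop_le[OF n c])
  moreover have "expectation ?S = expectation (\<lambda>\<omega>. (1 - ?I \<omega>) * (?S \<omega> - ?T \<omega>)) +
      expectation (\<lambda>\<omega>. (1 - ?I \<omega>) * ?T \<omega>) + expectation (\<lambda>\<omega>. ?I \<omega> * ?S \<omega>)"
    using S T IS IT by (simp add: left_diff_distrib right_diff_distrib)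
  ultimately show ?thesis
    using expectation_big_drop_assoc_le[OF sub assoc distr n, of m c]
    by (simp add: left_diff_distrib)
qed

end

section \<open>Passage to the limit\<close>

text \<open>The common end of both cases. The tail hypothesis at \<open>d * n\<close> instead of
  \<open>n\<close> gains a factor \<open>d\<close>, so for large \<open>d\<close> the level
  \<open>c = b (d * n)\<close> satisfies the smallness condition in \<open>drop\<close>; the limit
  inferior is then at least \<open>\<theta> / \<epsilon>\<close>.\<close>

lemma liminf_persistence_pos:
  fixes q :: "real \<Rightarrow> real" and b e P :: "nat \<Rightarrow> real" and \<epsilon> \<theta> \<delta> :: real
  assumes b: "\<And>n. n \<ge> 1 \<Longrightarrow> b n > 0" and "\<epsilon> > 0" "\<theta> > 0" "\<delta> > 0"
    and q: "\<And>c. q c \<ge> 0" and P: "\<And>n. P n \<ge> 0"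
    and lim: "limsup (\<lambda>n. ereal (real n * q (b n))) < \<infinity>"
    and e: "eventually (\<lambda>n. e n > 0) sequentially"
    and drop: "eventually (\<lambda>n. \<forall>c\<ge>0. real (nfloor \<epsilon> n) * q c \<le> \<delta> \<longrightarrow>
      \<theta> * e n \<le> real (nfloor \<epsilon> n) * c * P n) sequentially"
  shows "\<exists>d::nat. d > 0 \<and> liminf (\<lambda>n. ereal (real n * b (d * n) / e n * P n)) > 0"
proof -
  obtain K where K: "limsup (\<lambda>n. ereal (real n * q (b n))) < ereal K"
    using lim ereal_dense2 by blast
  from Limsup_lessD[OF K] obtain N where N: "\<And>n. n \<ge> N \<Longrightarrow> real n * q (b n) \<le> K"
    by (auto simp: eventually_sequentially intro: less_imp_le)
  obtain d0 :: nat where d0: "\<epsilon> * K / \<delta> \<le> real d0"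
    using real_arch_simple by blast
  \<comment> \<open>The successor keeps \<open>d\<close> positive even if
    \<open>d0 = 0\<close>.\<close>
  define d where "d = Suc d0"
  have "d > 0" and d: "\<epsilon> * K \<le> \<delta> * real d"
    using d0 \<open>\<delta> > 0\<close> by (auto simp: d_def field_simps)
  have floor: "real (nfloor \<epsilon> n) \<le> \<epsilon> * real n" for n
    using \<open>\<epsilon> > 0\<close> by (simp add: of_nat_floor)
  have "eventually (\<lambda>n. ereal (\<theta> / \<epsilon>) \<le> ereal (real n * b (d * n) / e n * P n)) sequentially"
    using e drop eventually_ge_at_top[of N] eventually_ge_at_top[of 1]
  proof eventually_elim
    case (elim n)
    have "d * n \<ge> n" using \<open>d > 0\<close> by simp
    then have "d * n \<ge> N" "d * n \<ge> 1"
      using elim by linarith+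
    then have K': "real (d * n) * q (b (d * n)) \<le> K" and "b (d * n) > 0"
      using N b by blast+
    have "real (nfloor \<epsilon> n) * q (b (d * n)) \<le> \<epsilon> * real n * q (b (d * n))"
      using floor q by (rule mult_right_mono)
    also have "\<dots> \<le> \<delta>"
    proof -
      have "real d * (\<epsilon> * real n * q (b (d * n))) = \<epsilon> * (real (d * n) * q (b (d * n)))"
        by simp
      also have "\<dots> \<le> \<epsilon> * K"
        using K' \<open>\<epsilon> > 0\<close> by (intro mult_left_mono) auto
      also have "\<dots> \<le> real d * \<delta>"
        using d by (simp add: mult.commute)
      finally show ?thesis
        using \<open>d > 0\<close> by (simp del: of_nat_mult)
    qed
    finally have "\<theta> * e n \<le> real (nfloor \<epsilon> n) * b (d * n) * P n"
      using elim \<open>b (d * n) > 0\<close> by auto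
    also have "\<dots> \<le> \<epsilon> * real n * b (d * n) * P n"
      using floor \<open>b (d * n) > 0\<close> P by (intro mult_right_mono) auto
    finally show ?case
      using \<open>e n > 0\<close> \<open>\<epsilon> > 0\<close> by (simp add: field_simps)
  qed
  then have "ereal (\<theta> / \<epsilon>) \<le> liminf (\<lambda>n. ereal (real n * b (d * n) / e n * P n))"
    by (rule Liminf_bounded)
  moreover have "0 < ereal (\<theta> / \<epsilon>)"
    using assms by simp
  ultimately show ?thesis
    using \<open>d > 0\<close> less_le_trans by blast
qed

text \<open>\<open>\<mu>\<close> solves \<open>\<mu> powr (1 - p) * C powr p = \<eta>\<close>, and
  the powers of \<open>e\<close> combine to \<open>e\<close> itself. Here \<open>A\<close> stands
  for a \<open>p\<close>-th moment and \<open>\<mu> * e\<close> for the level \<open>a\<close> at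
  which it is cut.\<close>

lemma powr_scaled_le:
  fixes A C p \<mu> e \<eta> :: real
  assumes "p > 1" "C > 0" "\<eta> > 0" "e > 0" and A: "A powr (1 / p) \<le> C * e" "A \<ge> 0"
    and \<mu>: "\<mu> = (C powr p / \<eta>) powr (1 / (p - 1))"
  shows "\<mu> > 0" and "(\<mu> * e) powr (1 - p) * A \<le> \<eta> * e"
proof -
  show "\<mu> > 0"
    using assms by simp
  have "A = (A powr (1 / p)) powr p"
    using assms by (simp add: powr_powr)
  also have "\<dots> \<le> (C * e) powr p"
    using assms by (intro powr_mono2) auto
  also have "\<dots> = C powr p * e powr p"
    using assms by (simp add: powr_mult)
  finally have "(\<mu> * e) powr (1 - p) * A \<le> (\<mu> * e) powr (1 - p) * (C powr p * e powr p)"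
    by (intro mult_left_mono) auto
  also have "\<dots> = \<mu> powr (1 - p) * C powr p * (e powr (1 - p) * e powr p)"
    using assms \<open>\<mu> > 0\<close> by (simp add: powr_mult)
  also have "e powr (1 - p) * e powr p = e"
    using assms by (simp add: powr_add[symmetric])
  also have "\<mu> powr (1 - p) = (C powr p / \<eta>) powr (- 1)"
  proof -
    have "1 / (p - 1) * (1 - p) = - 1"
      using \<open>p > 1\<close> by (simp add: field_simps)
    then show ?thesis
      unfolding \<mu> powr_powr by simp
  qed
  also have "\<dots> * C powr p = \<eta>"
    using assms by (simp add: powr_minus field_simps)
  finally show "(\<mu> * e) powr (1 - p) * A \<le> \<eta> * e" .
qed

section \<open>Persistence bounds and the criterion for \<open>star_condition\<close>\<close>

theorem theorem4:
  fixes M :: "'a measure" and Z :: "nat \<Rightarrow> 'a \<Rightarrow> real" and \<epsilon> :: real and \<rho> :: ereal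
  assumes "prob_space M"
    and "\<And>n. Z n \<in> borel_measurable M"
    and "centered M Z"
    and "stationary_increments M Z"
    and "\<epsilon> > 0"
    and "\<rho> = liminf (\<lambda>n. ereal (prob_space.expectation M (run_max Z 1 (n + nfloor \<epsilon> n)) /
                                prob_space.expectation M (run_max Z 1 n)))"
    and "\<rho> > 1"
  shows
    "(\<forall>b :: real. \<P>(\<omega> in M. - Z 1 \<omega> \<le> b) = 1 \<longrightarrow>
        liminf (\<lambda>n. ereal (\<epsilon> * real n / prob_space.expectation M (run_max Z 1 n) *
                           \<P>(\<omega> in M. run_max Z 1 n \<omega> < 0)))
          \<ge> (\<rho> - 1) / ereal b) \<and>
     (\<forall>b :: nat \<Rightarrow> real.
        (\<forall>n\<ge>1. b n > 0) \<longrightarrow>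
        limsup (\<lambda>n. ereal (real n * \<P>(\<omega> in M. - Z 1 \<omega> > b n))) < \<infinity> \<longrightarrow>
        (\<exists>p :: real. p > 1 \<and>
           limsup (\<lambda>n. ereal (inverse (prob_space.expectation M (run_max Z 1 n))) *
             Lp_norm M p (\<lambda>\<omega>. run_max Z 1 (n + nfloor \<epsilon> n) \<omega> - Z (n + nfloor \<epsilon> n) \<omega>)) < \<infinity>) \<or>
        (\<exists>F. subalgebra M F \<and> pos_assoc_increments_given M F Z \<and>
           cond_distr_increments_indep M F Z \<and> star_condition M Z \<epsilon> \<rho>) \<longrightarrow>
        (\<exists>d :: nat. d > 0 \<and>
           liminf (\<lambda>n. ereal (real n * b (d * n) / prob_space.expectation M (run_max Z 1 n) *
                              \<P>(\<omega> in M. run_max Z 1 n \<omega> < 0))) > 0)) \<and>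
     (\<rho> > 1 + limsup (\<lambda>n. ereal (prob_space.expectation M (\<lambda>\<omega>. max 0 (Z (nfloor \<epsilon> n + 1) \<omega>)) /
                                 prob_space.expectation M (run_max Z 1 n)))
        \<longrightarrow> star_condition M Z \<epsilon> \<rho>)"
proof -
  interpret centered_stationary_increments M Z
    using assms(1-4) by (simp add: centered_stationary_increments_def centered_stationary_increments_axioms_def)
  define e where "e n = expectation (run_max Z 1 n)" for n
  define P where "P n = \<P>(\<omega> in M. run_max Z 1 n \<omega> < 0)" for n
  define q where "q c = \<P>(\<omega> in M. c < - Z 1 \<omega>)" for c
  define m where "m n = nfloor \<epsilon> n" for n
  have m_le: "real (m n) \<le> \<epsilon> * real n" for n
    using \<open>\<epsilon> > 0\<close> by (simp add: m_def of_nat_floor)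
  have \<rho>_eq: "\<rho> = liminf (\<lambda>n. ereal (e (m n + n) / e n))"
    unfolding assms(6) e_def m_def by (simp add: add.commute)
  have "eventually (\<lambda>n. 1 < ereal (e (m n + n) / e n)) sequentially"
    using assms(7) unfolding \<rho>_eq by (rule less_LiminfD)
  then have e_pos: "eventually (\<lambda>n. e n > 0) sequentially"
    using eventually_ge_at_top[of 1]
  proof eventually_elim
    case (elim n)
    \<comment> \<open>Division by zero yields 0, so a ratio above 1 excludes
      \<open>e n = 0\<close>.\<close>
    then have "e n \<noteq> 0" by auto
    then show ?case
      using expectation_run_max_nonneg[of n] elim by (simp add: e_def)
  qed
  have ratio: "eventually (\<lambda>n. r * e n < e (m n + n)) sequentially" if "ereal r < \<rho>" for r
    using less_LiminfD[OF that[unfolded \<rho>_eq]] e_pos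
    by eventually_elim (simp add: less_divide_eq)

  have bounded_case: "(\<rho> - 1) / ereal b \<le> liminf (\<lambda>n. ereal (\<epsilon> * real n / e n * P n))"
    if b: "\<P>(\<omega> in M. - Z 1 \<omega> \<le> b) = 1" for b
  proof -
    have drop: "e (m n + n) - e n \<le> real (m n) * b * P n" if "n \<ge> 1" for n
      using expectation_run_max_drop_le_bounded(1)[OF that b, of "m n"] by (simp add: e_def P_def)
    have "b \<ge> 0"
      using expectation_run_max_drop_le_bounded(2)[OF order_refl b] .
    \<comment> \<open>With \<open>b = 0\<close> the expected maximum would not grow from
      \<open>n\<close> to \<open>m n + n\<close>, contradicting \<open>\<rho> > 1\<close>.\<close>
    moreover have "b \<noteq> 0"
    proof
      assume "b = 0"
      have "eventually (\<lambda>n::nat. False) sequentially"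
        using ratio[OF assms(7)[unfolded one_ereal_def]] eventually_ge_at_top[of 1]
        by eventually_elim (use drop \<open>b = 0\<close> in fastforce)
      then show False by simp
    qed
    ultimately have "b > 0" by simp
    show ?thesis
      \<comment> \<open>Testing each \<open>y\<close> below the bound avoids arithmetic with a
        possibly infinite \<open>\<rho>\<close>.\<close>
      unfolding le_Liminf_iff
    proof (intro allI impI)
      fix y assume y: "y < (\<rho> - 1) / ereal b"
      show "eventually (\<lambda>n. y < ereal (\<epsilon> * real n / e n * P n)) sequentially"
      proof (cases y)
        case (real r)
        then have "ereal (b * r) < \<rho> - 1"
          using y \<open>b > 0\<close> by (simp add: ereal_less_divide_pos)
        then have "ereal (1 + b * r) < \<rho>"
          by (cases \<rho>) (auto simp: one_ereal_def)
        from ratio[OF this] e_pos eventually_ge_at_top[of 1] show ?thesis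
        proof eventually_elim
          case (elim n)
          have "b * (r * e n) < real (m n) * b * P n"
            using elim drop[of n] by (simp add: algebra_simps)
          also have "\<dots> \<le> \<epsilon> * real n * b * P n"
            using m_le \<open>b > 0\<close> by (intro mult_right_mono) (auto simp: P_def)
          finally have "b * (r * e n) < b * (\<epsilon> * real n * P n)"
            by (simp add: ac_simps)
          then show ?case
            using \<open>b > 0\<close> elim by (simp add: real less_divide_eq)
        qed
      qed (use y in auto)
    qed
  qed

  have persistence: "\<exists>d::nat. d > 0 \<and> liminf (\<lambda>n. ereal (real n * b (d * n) / e n * P n)) > 0"
    if b: "\<forall>n\<ge>1. b n > 0" and lim: "limsup (\<lambda>n. ereal (real n * q (b n))) < \<infinity>"
      and "\<theta> > 0" "\<delta> > 0"
      and drop: "eventually (\<lambda>n. \<forall>c\<ge>0. real (m n) * q c \<le> \<delta> \<longrightarrow> \<theta> * e n \<le> real (m n) * c * P n) sequentially"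
    for b \<theta> \<delta>
  proof (rule liminf_persistence_pos[where q = q and \<epsilon> = \<epsilon> and \<theta> = \<theta> and \<delta> = \<delta>])
    show "eventually (\<lambda>n. \<forall>c\<ge>0. real (nfloor \<epsilon> n) * q c \<le> \<delta> \<longrightarrow>
        \<theta> * e n \<le> real (nfloor \<epsilon> n) * c * P n) sequentially"
      using drop by (simp add: m_def)
  qed (use that \<open>\<epsilon> > 0\<close> e_pos in \<open>auto simp: q_def P_def\<close>)

  have Lp_case: "\<exists>\<theta> \<delta>. \<theta> > 0 \<and> \<delta> > 0 \<and>
      eventually (\<lambda>n. \<forall>c\<ge>0. real (m n) * q c \<le> \<delta> \<longrightarrow> \<theta> * e n \<le> real (m n) * c * P n) sequentially"
    if "p > 1" and lim: "limsup (\<lambda>n. ereal (inverse (e n)) *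
      Lp_norm M p (\<lambda>\<omega>. run_max Z 1 (n + nfloor \<epsilon> n) \<omega> - Z (n + nfloor \<epsilon> n) \<omega>)) < \<infinity>" for p
  proof -
    define Y where "Y n = (\<lambda>\<omega>. \<bar>run_max Z 1 (m n + n) \<omega> - Z (m n + n) \<omega>\<bar> powr p)" for n
    obtain C0 where C0: "limsup (\<lambda>n. ereal (inverse (e n)) *
        Lp_norm M p (\<lambda>\<omega>. run_max Z 1 (n + nfloor \<epsilon> n) \<omega> - Z (n + nfloor \<epsilon> n) \<omega>)) < ereal C0"
      using lim ereal_dense2 by blast
    define C where "C = max C0 1"
    have "C > 0" by (simp add: C_def)
    have Y: "eventually (\<lambda>n. integrable M (Y n) \<and> expectation (Y n) powr (1 / p) \<le> C * e n) sequentially"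
      using Limsup_lessD[OF C0] e_pos
    proof eventually_elim
      case (elim n)
      have Lp: "Lp_norm M p (\<lambda>\<omega>. run_max Z 1 (n + nfloor \<epsilon> n) \<omega> - Z (n + nfloor \<epsilon> n) \<omega>) =
          (if integrable M (Y n) then ereal (expectation (Y n) powr (1 / p)) else \<infinity>)"
        by (simp add: Lp_norm_def Y_def m_def add.commute)
      \<comment> \<open>An infinite norm times the positive factor \<open>inverse (e n)\<close>
        would be infinite.\<close>
      have "integrable M (Y n)"
        using elim unfolding Lp by (auto split: if_splits)
      then have "inverse (e n) * expectation (Y n) powr (1 / p) < C0"
        using elim unfolding Lp by simp
      then have "expectation (Y n) powr (1 / p) < C0 * e n"
        using elim by (simp add: field_simps)
      moreover have "C0 * e n \<le> C * e n"
        using elim by (intro mult_right_mono) (auto simp: C_def)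
      ultimately have "expectation (Y n) powr (1 / p) \<le> C * e n"
        by simp
      with \<open>integrable M (Y n)\<close> show ?case by simp
    qed
    obtain r where r: "1 < ereal r" "ereal r < \<rho>"
      using ereal_dense2[OF assms(7)] by blast
    \<comment> \<open>The growth exceeds \<open>4 * \<eta> * e n\<close>; the exceptional event and
      the moment term cost at most \<open>\<eta> * e n\<close> each, which leaves
      \<open>2 * \<eta>\<close> for \<open>\<theta>\<close>.\<close>
    define \<eta> where "\<eta> = (r - 1) / 4"
    have "\<eta> > 0" using r by (simp add: \<eta>_def one_ereal_def)
    define \<mu> where "\<mu> = (C powr p / \<eta>) powr (1 / (p - 1))"
    have "\<mu> > 0" using \<open>C > 0\<close> \<open>\<eta> > 0\<close> by (simp add: \<mu>_def)
    \<comment> \<open>The threshold \<open>\<eta> / \<mu>\<close> is what makes level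
      \<open>\<mu> * e n\<close> times the probability of a large drop at most
      \<open>\<eta> * e n\<close>.\<close>
    have "eventually (\<lambda>n. \<forall>c\<ge>0. real (m n) * q c \<le> \<eta> / \<mu> \<longrightarrow> (2 * \<eta>) * e n \<le> real (m n) * c * P n) sequentially"
      using Y ratio[OF r(2)] e_pos eventually_ge_at_top[of 1]
    proof eventually_elim
      case (elim n)
      show ?case
      proof (intro allI impI)
        fix c :: real assume c: "0 \<le> c" "real (m n) * q c \<le> \<eta> / \<mu>"
        have "e (m n + n) - e n \<le> real (m n) * c * P n + (\<mu> * e n * prob (big_drop (m n) c) +
            (\<mu> * e n) powr (1 - p) * expectation (Y n))"
          using expectation_run_max_drop_le[of n c "m n"] elim c \<open>\<mu> > 0\<close>
            expectation_big_drop_Lp_le[of n p "\<mu> * e n" "m n" c] \<open>p > 1\<close>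
          by (simp add: e_def P_def Y_def)
        moreover have "(\<mu> * e n) powr (1 - p) * expectation (Y n) \<le> \<eta> * e n"
          using elim by (intro powr_scaled_le(2)[OF \<open>p > 1\<close> \<open>C > 0\<close> \<open>\<eta> > 0\<close> _ _ _ \<mu>_def])
            (auto simp: Y_def)
        moreover have "\<mu> * e n * prob (big_drop (m n) c) \<le> \<eta> * e n"
        proof -
          have "prob (big_drop (m n) c) \<le> \<eta> / \<mu>"
            using prob_big_drop_le[of "m n" c] c by (simp add: q_def)
          then have "\<mu> * prob (big_drop (m n) c) \<le> \<eta>"
            using \<open>\<mu> > 0\<close> by (simp add: field_simps)
          then show ?thesis
            using elim mult_right_mono[of "\<mu> * prob (big_drop (m n) c)" \<eta> "e n"] by (simp add: ac_simps)
        qed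
        moreover have "r * e n = 4 * (\<eta> * e n) + e n"
          by (simp add: \<eta>_def field_simps)
        ultimately show "(2 * \<eta>) * e n \<le> real (m n) * c * P n"
          using elim unfolding mult.assoc by linarith
      qed
    qed
    moreover have "\<eta> / \<mu> > 0" "2 * \<eta> > 0"
      using \<open>\<mu> > 0\<close> \<open>\<eta> > 0\<close> by auto
    ultimately show ?thesis by blast
  qed

  have star_eq: "star_condition M Z \<epsilon> \<rho> \<longleftrightarrow>
      limsup (\<lambda>n. ereal (expectation (\<lambda>\<omega>. max 0 (run_max Z (Suc (m n)) (m n + n) \<omega>)) / e n)) < \<rho>"
    by (simp add: star_condition_def m_def e_def add.commute)

  have assoc_case: "\<exists>\<theta> \<delta>. \<theta> > 0 \<and> \<delta> > 0 \<and>
      eventually (\<lambda>n. \<forall>c\<ge>0. real (m n) * q c \<le> \<delta> \<longrightarrow> \<theta> * e n \<le> real (m n) * c * P n) sequentially"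
    if F: "subalgebra M F" "pos_assoc_increments_given M F Z" "cond_distr_increments_indep M F Z"
      and star: "star_condition M Z \<epsilon> \<rho>" for F
  proof -
    let ?W = "\<lambda>n. expectation (\<lambda>\<omega>. max 0 (run_max Z (Suc (m n)) (m n + n) \<omega>))"
    \<comment> \<open>The maximum with 1 makes \<open>s\<close>, and hence \<open>r\<close>,
      positive, as the division by \<open>2 * r\<close> below demands.\<close>
    have "max 1 (limsup (\<lambda>n. ereal (?W n / e n))) < \<rho>"
      using star assms(7) by (simp add: star_eq)
    from ereal_dense2[OF this] obtain s
      where s: "1 < ereal s" "limsup (\<lambda>n. ereal (?W n / e n)) < ereal s" "ereal s < \<rho>"
      by auto
    then obtain r where r: "ereal s < ereal r" "ereal r < \<rho>"
      using ereal_dense2 by blast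
    have "1 < s" "s < r" using s r by (auto simp: one_ereal_def)
    \<comment> \<open>With this \<open>\<delta>\<close>, the factor
      \<open>(1 - \<delta>) * r\<close> is the midpoint of \<open>s\<close> and \<open>r\<close>, so
      \<open>(r - s) / 2\<close> remains after subtracting \<open>s\<close>.\<close>
    define \<delta> where "\<delta> = (r - s) / (2 * r)"
    have \<delta>: "\<delta> > 0" "\<delta> \<le> 1" "(1 - \<delta>) * r = s + (r - s) / 2"
      using \<open>1 < s\<close> \<open>s < r\<close> by (auto simp: \<delta>_def field_simps)
    have "eventually (\<lambda>n. \<forall>c\<ge>0. real (m n) * q c \<le> \<delta> \<longrightarrow> (r - s) / 2 * e n \<le> real (m n) * c * P n) sequentially"
      using Limsup_lessD[OF s(2)] ratio[OF r(2)] e_pos eventually_ge_at_top[of 1]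
    proof eventually_elim
      case (elim n)
      show ?case
      proof (intro allI impI)
        fix c :: real assume c: "0 \<le> c" "real (m n) * q c \<le> \<delta>"
        have "(1 - \<delta>) * (r * e n) \<le> (1 - real (m n) * q c) * e (m n + n)"
          using elim c \<delta> \<open>1 < s\<close> \<open>s < r\<close> by (intro mult_mono) auto
        also have "\<dots> \<le> real (m n) * c * P n + ?W n"
          using expectation_run_max_assoc_le[OF F, of n c "m n"] elim c by (simp add: e_def P_def q_def)
        also have "?W n \<le> s * e n"
          using elim by (simp add: divide_less_eq)
        finally have "((1 - \<delta>) * r) * e n \<le> real (m n) * c * P n + s * e n"
          by (simp add: mult.assoc)
        then show "(r - s) / 2 * e n \<le> real (m n) * c * P n"
          unfolding \<delta>(3) by (simp add: distrib_right)
      qed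
    qed
    moreover have "(r - s) / 2 > 0" using \<open>s < r\<close> by simp
    ultimately show ?thesis using \<delta>(1) by blast
  qed

  have star_criterion: "star_condition M Z \<epsilon> \<rho>"
    if "1 + limsup (\<lambda>n. ereal (expectation (\<lambda>\<omega>. max 0 (Z (nfloor \<epsilon> n + 1) \<omega>)) / e n)) < \<rho>"
  proof -
    let ?u = "\<lambda>n. expectation (\<lambda>\<omega>. max 0 (Z (nfloor \<epsilon> n + 1) \<omega>)) / e n"
    have "limsup (\<lambda>n. ereal (expectation (\<lambda>\<omega>. max 0 (run_max Z (Suc (m n)) (m n + n) \<omega>)) / e n)) \<le>
        limsup (\<lambda>n. 1 + ereal (?u n))"
    proof (rule Limsup_mono)
      show "eventually (\<lambda>n. ereal (expectation (\<lambda>\<omega>. max 0 (run_max Z (Suc (m n)) (m n + n) \<omega>)) / e n) \<le>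
          1 + ereal (?u n)) sequentially"
        using e_pos eventually_ge_at_top[of 1]
      proof eventually_elim
        case (elim n)
        have "expectation (\<lambda>\<omega>. max 0 (run_max Z (Suc (m n)) (m n + n) \<omega>)) \<le>
            expectation (\<lambda>\<omega>. max 0 (Z (nfloor \<epsilon> n + 1) \<omega>)) + e n"
          using expectation_max_0_run_max_le[of n "m n"] elim by (simp add: m_def e_def)
        \<comment> \<open>Dividing by \<open>e n\<close> turns the second summand into the constant
          1 of the criterion.\<close>
        then show ?case
          using elim by (simp add: one_ereal_def field_simps)
      qed
    qed
    also have "\<dots> = 1 + limsup (\<lambda>n. ereal (?u n))"
      by (rule Limsup_add_ereal_left) auto
    finally show ?thesis
      using that by (simp add: star_eq)
  qed

  show ?thesis
    unfolding e_def[symmetric] P_def[symmetric] q_def[symmetric]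
  proof (intro conjI allI impI, goal_cases)
    case (1 b)
    then show ?case by (rule bounded_case)
  next
    case (2 b)
    from 2(3) obtain \<theta> \<delta> where "\<theta> > 0" "\<delta> > 0"
      "eventually (\<lambda>n. \<forall>c\<ge>0. real (m n) * q c \<le> \<delta> \<longrightarrow> \<theta> * e n \<le> real (m n) * c * P n) sequentially"
      using Lp_case assoc_case by blast
    then show ?case by (rule persistence[OF 2(1,2)])
  next
    case 3
    then show ?case by (rule star_criterion)
  qed
qed

end
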